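(* Let $\phi:\mathbb{P}^n\to\mathbb{P}^n$ be an endomorphism of degree at least $2$, defined over $\mathbb{C}$. Then for every integer $d\ge1$ the set \[ \mathrm{Com}(\phi,d)=\{\psi:\mathbb{P}^n\to\mathbb{P}^n \text{ endomorphism} : \psi\circ\phi=\phi\circ\psi,\ \deg\psi=d\} \] is finite. *)

theory Defs
  imports "HOL-Analysis.Analysis"
begin

text \<open>The type \<open>'n\<close> indexes the homogeneous coordinates: for \<open>CARD('n) = n + 1\<close>, the type
  \<open>'n proj_space\<close> is the set of complex points of the projective space of dimension \<open>n\<close>.\<close>

definition proj_rel :: "complex ^ 'n::finite \<Rightarrow> complex ^ 'n \<Rightarrow> bool" where
  "proj_rel x y \<longleftrightarrow> x \<noteq> 0 \<and> y \<noteq> 0 \<and> (\<exists>c. c \<noteq> 0 \<and> x = c *s y)"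

lemma part_equivp_proj_rel: "part_equivp (proj_rel :: complex ^ 'n::finite \<Rightarrow> _)"
proof (rule part_equivpI)
  show "\<exists>x :: complex ^ 'n. proj_rel x x"
    by (rule exI[of _ 1]) (auto simp: proj_rel_def intro!: exI[of _ 1])
  show "symp (proj_rel :: complex ^ 'n \<Rightarrow> _)"
  proof (rule sympI)
    fix x y :: "complex ^ 'n" assume "proj_rel x y"
    then obtain c where c: "x \<noteq> 0" "y \<noteq> 0" "c \<noteq> 0" "x = c *s y"
      by (auto simp: proj_rel_def)
    then have "y = inverse c *s x"
      by (simp add: vector_smult_assoc)
    with c show "proj_rel y x"
      unfolding proj_rel_def by (metis inverse_nonzero_iff_nonzero)
  qed
  show "transp (proj_rel :: complex ^ 'n \<Rightarrow> _)"
  proof (rule transpI)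
    fix x y z :: "complex ^ 'n" assume "proj_rel x y" "proj_rel y z"
    then obtain b c where "x \<noteq> 0" "z \<noteq> 0" "b \<noteq> 0" "c \<noteq> 0" "x = b *s y" "y = c *s z"
      by (auto simp: proj_rel_def)
    then show "proj_rel x z"
      unfolding proj_rel_def by (metis vector_smult_assoc mult_eq_0_iff)
  qed
qed

quotient_type 'n proj_space = "complex ^ ('n::finite)" / partial: proj_rel
  by (rule part_equivp_proj_rel)

text \<open>\<open>proj_point x\<close> is the point with homogeneous coordinates \<open>x\<close>; it is meaningful only for
  \<open>x \<noteq> 0\<close>.\<close>

definition proj_point :: "complex ^ 'n::finite \<Rightarrow> 'n proj_space" where
  "proj_point x = abs_proj_space x"

lemma proj_point_eq_iff:
  assumes "x \<noteq> 0" "y \<noteq> 0"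
  shows "proj_point x = proj_point y \<longleftrightarrow> (\<exists>c. c \<noteq> 0 \<and> x = c *s y)"
proof -
  have refl: "proj_rel z z" if "z \<noteq> 0" for z :: "complex ^ 'n"
    using that by (auto simp: proj_rel_def intro!: exI[of _ 1])
  show ?thesis
    using Quotient_rel[OF Quotient_proj_space, of x y] refl assms
    by (auto simp: proj_point_def proj_rel_def)
qed

lemma proj_point_exhaust: "\<exists>x. x \<noteq> 0 \<and> p = proj_point x"
proof -
  have "proj_rel (rep_proj_space p) (rep_proj_space p)"
    by (rule Quotient_rep_reflp[OF Quotient_proj_space])
  moreover have "p = proj_point (rep_proj_space p)"
    by (simp add: proj_point_def Quotient_abs_rep[OF Quotient_proj_space])
  ultimately show ?thesis
    unfolding proj_rel_def by blast
qed

text \<open>Forms of degree \<open>d\<close> as functions: complex linear combinations of the monomials with exponent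
  vectors of total degree \<open>d\<close>. As the field is infinite, polynomials and polynomial functions
  need not be distinguished.\<close>

definition homogeneous_form :: "nat \<Rightarrow> (complex ^ 'n::finite \<Rightarrow> complex) \<Rightarrow> bool" where
  "homogeneous_form d f \<longleftrightarrow>
     (\<exists>c :: ('n \<Rightarrow> nat) \<Rightarrow> complex.
        f = (\<lambda>x. \<Sum>\<alpha> \<in> {\<alpha>. (\<Sum>i\<in>UNIV. \<alpha> i) = d}. c \<alpha> * (\<Prod>i\<in>UNIV. (x $ i) ^ \<alpha> i)))"

lemma finite_exponents: "finite {\<alpha> :: 'n::finite \<Rightarrow> nat. (\<Sum>i\<in>UNIV. \<alpha> i) = d}"
proof (rule finite_subset)
  show "{\<alpha> :: 'n \<Rightarrow> nat. (\<Sum>i\<in>UNIV. \<alpha> i) = d} \<subseteq> (UNIV :: 'n set) \<rightarrow>\<^sub>E {..d}"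
    by (auto simp: PiE_def intro: member_le_sum)
  show "finite ((UNIV :: 'n set) \<rightarrow>\<^sub>E {..d})"
    by (rule finite_PiE) auto
qed

text \<open>An endomorphism of degree \<open>d\<close> is a map \<open>[F\<^sub>0 : \<dots> : F\<^sub>n]\<close> whose components are forms of
  degree \<open>d\<close> without common zero other than the origin. The degree is a relation rather than a
  function of the map; \<open>d\<close> is determined by \<open>\<phi>\<close> unless \<open>CARD('n) = 1\<close>, when the space is a point.\<close>

definition endomorphism_of_degree ::
    "nat \<Rightarrow> ('n::finite proj_space \<Rightarrow> 'n proj_space) \<Rightarrow> bool" where
  "endomorphism_of_degree d \<phi> \<longleftrightarrow>
     (\<exists>F :: 'n \<Rightarrow> complex ^ 'n \<Rightarrow> complex.
        (\<forall>i. homogeneous_form d (F i)) \<and>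
        (\<forall>x. (\<forall>i. F i x = 0) \<longrightarrow> x = 0) \<and>
        (\<forall>x. x \<noteq> 0 \<longrightarrow> \<phi> (proj_point x) = proj_point (\<chi> i. F i x)))"

definition Com :: "('n::finite proj_space \<Rightarrow> 'n proj_space) \<Rightarrow> nat
    \<Rightarrow> ('n proj_space \<Rightarrow> 'n proj_space) set" where
  "Com \<phi> d = {\<psi>. endomorphism_of_degree d \<psi> \<and> \<psi> \<circ> \<phi> = \<phi> \<circ> \<psi>}"

end

theory Submission
  imports Defs "HOL-Computational_Algebra.Fundamental_Theorem_Algebra"
    "HOL-Complex_Analysis.Cauchy_Integral_Formula"
begin

text \<open>Let \<open>\<Phi>\<close> be a homogeneous lift of \<open>\<phi>\<close>. By Liouville's theorem and \<open>k \<ge> 2\<close>, every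
  \<open>\<psi>\<close> in \<open>Com \<phi> d\<close> has a lift \<open>\<Psi>\<close> that commutes with \<open>\<Phi>\<close> exactly, not only up to
  scalars. The coefficient vectors of such \<open>\<Psi>\<close> form an affine algebraic set \<open>S\<close>. Since \<open>\<Psi>\<close>
  preserves the set of points with bounded \<open>\<Phi>\<close>-orbit, which is bounded and contains a ball
  around the origin, each value \<open>\<Psi>(x)\<close> with \<open>x\<close> in that ball is a bounded polynomial function on
  \<open>S\<close>. A bounded polynomial function on a complex affine algebraic set takes only finitely many
  values (a form of the Nullstellensatz), and finitely many of the values \<open>\<Psi>(x)\<close> determine
  \<open>\<Psi>\<close>.\<close>

section \<open>Bounded polynomial functions on affine algebraic sets\<close>

text \<open>Multiplying by one coordinate at a time keeps the inductions short and leads directly to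
  an expansion into words over \<open>B\<close>. The argument \<open>v\<close> stays a total
  function, of which only the coordinates in \<open>B\<close> enter.\<close>

inductive_set poly_fun :: "'b set \<Rightarrow> (('b \<Rightarrow> complex) \<Rightarrow> complex) set" for B where
  const: "(\<lambda>_. c) \<in> poly_fun B"
| add: "f \<in> poly_fun B \<Longrightarrow> g \<in> poly_fun B \<Longrightarrow> (\<lambda>v. f v + g v) \<in> poly_fun B"
| coord_mult: "b \<in> B \<Longrightarrow> f \<in> poly_fun B \<Longrightarrow> (\<lambda>v. v b * f v) \<in> poly_fun B"

lemma poly_fun_cmult: "f \<in> poly_fun B \<Longrightarrow> (\<lambda>v. c * f v) \<in> poly_fun B"
proof (induction rule: poly_fun.induct)
  case (const a)
  show ?case by (rule poly_fun.const)
next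
  case (add f g)
  then show ?case using poly_fun.add[OF add.IH] by (simp add: distrib_left)
next
  case (coord_mult b f)
  then show ?case using poly_fun.coord_mult[OF coord_mult.hyps(1) coord_mult.IH]
    by (simp add: mult.left_commute)
qed

lemma poly_fun_mult:
  assumes "f \<in> poly_fun B" "g \<in> poly_fun B"
  shows "(\<lambda>v. f v * g v) \<in> poly_fun B"
  using assms(1)
proof (induction rule: poly_fun.induct)
  case (const a)
  show ?case using assms(2) by (rule poly_fun_cmult)
next
  case (add f g)
  then show ?case using poly_fun.add[OF add.IH] by (simp add: distrib_right)
next
  case (coord_mult b f)
  then show ?case using poly_fun.coord_mult[OF coord_mult.hyps(1) coord_mult.IH]
    by (simp add: mult.assoc)
qed

lemma poly_fun_coord: "b \<in> B \<Longrightarrow> (\<lambda>v. v b) \<in> poly_fun B"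
  using poly_fun.coord_mult[OF _ poly_fun.const[of 1]] by simp

lemma poly_fun_diff:
  "f \<in> poly_fun B \<Longrightarrow> g \<in> poly_fun B \<Longrightarrow> (\<lambda>v. f v - g v) \<in> poly_fun B"
  using poly_fun.add[OF _ poly_fun_cmult[of g B "-1"], of f] by simp

lemma poly_fun_sum:
  "(\<And>i. i \<in> J \<Longrightarrow> f i \<in> poly_fun B) \<Longrightarrow> (\<lambda>v. \<Sum>i\<in>J. f i v) \<in> poly_fun B"
  by (induction J rule: infinite_finite_induct) (auto intro: poly_fun.const poly_fun.add)

lemma poly_fun_prod:
  "(\<And>i. i \<in> J \<Longrightarrow> f i \<in> poly_fun B) \<Longrightarrow> (\<lambda>v. \<Prod>i\<in>J. f i v) \<in> poly_fun B"
  by (induction J rule: infinite_finite_induct) (auto intro: poly_fun.const poly_fun_mult)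

lemma poly_fun_power: "f \<in> poly_fun B \<Longrightarrow> (\<lambda>v. f v ^ m) \<in> poly_fun B"
  by (induction m) (auto intro: poly_fun.const poly_fun_mult)

text \<open>Words over \<open>B\<close> serve as monomials. Several words may give the same product,
  which is harmless: what counts later is that a finite \<open>B\<close> has only countably many
  words.\<close>

lemma poly_fun_monomials:
  assumes "f \<in> poly_fun B"
  shows "\<exists>L a. finite L \<and> L \<subseteq> lists B \<and> f = (\<lambda>v. \<Sum>l\<in>L. a l * prod_list (map v l))"
  using assms
proof (induction rule: poly_fun.induct)
  case (const c)
  show ?case
    by (intro exI[of _ "{[]}"] exI[of _ "\<lambda>_. c"]) auto
next
  case (add f g)
  then obtain L a M b where
    f: "finite L" "L \<subseteq> lists B" "f = (\<lambda>v. \<Sum>l\<in>L. a l * prod_list (map v l))" and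
    g: "finite M" "M \<subseteq> lists B" "g = (\<lambda>v. \<Sum>l\<in>M. b l * prod_list (map v l))"
    by blast
  define c where "c l = (if l \<in> L then a l else 0) + (if l \<in> M then b l else 0)" for l
  have "f v + g v = (\<Sum>l\<in>L \<union> M. c l * prod_list (map v l))" for v
  proof -
    have "f v = (\<Sum>l\<in>L \<union> M. (if l \<in> L then a l else 0) * prod_list (map v l))"
      unfolding f(3) using f(1) g(1) by (intro sum.mono_neutral_cong_left) auto
    moreover have "g v = (\<Sum>l\<in>L \<union> M. (if l \<in> M then b l else 0) * prod_list (map v l))"
      unfolding g(3) using f(1) g(1) by (intro sum.mono_neutral_cong_left) auto
    ultimately show ?thesis
      by (simp add: c_def distrib_right sum.distrib)
  qed
  with f g show ?case
    by (intro exI[of _ "L \<union> M"] exI[of _ c]) auto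
next
  case (coord_mult b f)
  then obtain L a where
    f: "finite L" "L \<subseteq> lists B" "f = (\<lambda>v. \<Sum>l\<in>L. a l * prod_list (map v l))"
    by blast
  \<comment> \<open>Prepending \<open>b\<close> is injective on words, and \<open>tl\<close>
    recovers the old coefficient.\<close>
  have "v b * f v = (\<Sum>l\<in>(#) b ` L. a (tl l) * prod_list (map v l))" for v
    unfolding f(3) by (subst sum.reindex) (auto simp: sum_distrib_left mult_ac)
  with f(1,2) coord_mult.hyps(1) show ?case
    by (intro exI[of _ "(#) b ` L"] exI[of _ "\<lambda>l. a (tl l)"]) (auto simp: in_lists_conv_set subset_iff)
qed

text \<open>There are more unknowns than equations. The equations are handled one at a time: two
  solutions of the old ones with disjoint supports combine into a solution of the new one.\<close>

lemma nontrivial_linear_relation: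
  fixes a :: "'u \<Rightarrow> 'l \<Rightarrow> 'k::field"
  assumes "finite L" "infinite U"
  shows "\<exists>T c. finite T \<and> T \<subseteq> U \<and> (\<exists>\<mu>\<in>T. c \<mu> \<noteq> 0) \<and> (\<forall>l\<in>L. (\<Sum>\<mu>\<in>T. c \<mu> * a \<mu> l) = 0)"
  using assms
proof (induction L arbitrary: U rule: finite_induct)
  case empty
  then obtain \<mu> where "\<mu> \<in> U" by (metis finite.emptyI all_not_in_conv)
  then show ?case by (intro exI[of _ "{\<mu>}"] exI[of _ "\<lambda>_. 1"]) auto
next
  case (insert l L)
  obtain T c where T: "finite T" "T \<subseteq> U" "\<exists>\<mu>\<in>T. c \<mu> \<noteq> 0" "\<forall>l\<in>L. (\<Sum>\<mu>\<in>T. c \<mu> * a \<mu> l) = 0"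
    using insert.IH[OF insert.prems] by blast
  have "infinite (U - T)" using T(1) insert.prems by simp
  then obtain T' c' where T': "finite T'" "T' \<subseteq> U - T" "\<exists>\<mu>\<in>T'. c' \<mu> \<noteq> 0"
      "\<forall>l\<in>L. (\<Sum>\<mu>\<in>T'. c' \<mu> * a \<mu> l) = 0"
    using insert.IH[OF \<open>infinite (U - T)\<close>] by blast
  define s where "s = (\<Sum>\<mu>\<in>T. c \<mu> * a \<mu> l)"
  define s' where "s' = (\<Sum>\<mu>\<in>T'. c' \<mu> * a \<mu> l)"
  show ?case
  proof (cases "s = 0")
    case True
    with T show ?thesis by (intro exI[of _ T] exI[of _ c]) (auto simp: s_def)
  next
    case False
    \<comment> \<open>This combination cancels equation \<open>l\<close>. It is nontrivial on
      \<open>T'\<close> because \<open>s\<close> is nonzero and the supports are disjoint.\<close>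
    define e where "e \<mu> = (if \<mu> \<in> T then s' * c \<mu> else - s * c' \<mu>)" for \<mu>
    have disj: "T \<inter> T' = {}" using T'(2) by auto
    have e: "(\<Sum>\<mu>\<in>T \<union> T'. e \<mu> * a \<mu> j) = s' * (\<Sum>\<mu>\<in>T. c \<mu> * a \<mu> j) - s * (\<Sum>\<mu>\<in>T'. c' \<mu> * a \<mu> j)" for j
    proof -
      have "(\<Sum>\<mu>\<in>T. e \<mu> * a \<mu> j) = s' * (\<Sum>\<mu>\<in>T. c \<mu> * a \<mu> j)"
        by (simp add: e_def sum_distrib_left mult.assoc)
      moreover have "(\<Sum>\<mu>\<in>T'. e \<mu> * a \<mu> j) = - s * (\<Sum>\<mu>\<in>T'. c' \<mu> * a \<mu> j)"
        unfolding sum_distrib_left using disj by (intro sum.cong) (auto simp: e_def)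
      ultimately show ?thesis
        using T(1) T'(1) disj by (simp add: sum.union_disjoint)
    qed
    obtain \<mu> where "\<mu> \<in> T'" "c' \<mu> \<noteq> 0" using T'(3) by blast
    then have "\<mu> \<in> T \<union> T'" "e \<mu> \<noteq> 0" using disj False by (auto simp: e_def)
    moreover have "\<forall>j\<in>insert l L. (\<Sum>\<mu>\<in>T \<union> T'. e \<mu> * a \<mu> j) = 0"
      unfolding e using T(4) T'(4) by (auto simp: s_def s'_def)
    ultimately show ?thesis
      using T(1,2) T'(1,2) by (intro exI[of _ "T \<union> T'"] exI[of _ e]) auto
  qed
qed

section \<open>Ideals of polynomial functions\<close>

definition poly_ideal :: "'b set \<Rightarrow> (('b \<Rightarrow> complex) \<Rightarrow> complex) set \<Rightarrow> bool" where
  "poly_ideal B I \<longleftrightarrow> I \<subseteq> poly_fun B \<and> (\<lambda>_. 0) \<in> I \<and>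
     (\<forall>f\<in>I. \<forall>g\<in>I. (\<lambda>v. f v + g v) \<in> I) \<and>
     (\<forall>f\<in>poly_fun B. \<forall>g\<in>I. (\<lambda>v. f v * g v) \<in> I)"

lemma poly_ideal_mult:
  "poly_ideal B I \<Longrightarrow> f \<in> poly_fun B \<Longrightarrow> g \<in> I \<Longrightarrow> (\<lambda>v. f v * g v) \<in> I"
  by (auto simp: poly_ideal_def)

lemma poly_ideal_add:
  "poly_ideal B I \<Longrightarrow> f \<in> I \<Longrightarrow> g \<in> I \<Longrightarrow> (\<lambda>v. f v + g v) \<in> I"
  by (auto simp: poly_ideal_def)

lemma poly_ideal_diff:
  "poly_ideal B I \<Longrightarrow> f \<in> I \<Longrightarrow> g \<in> I \<Longrightarrow> (\<lambda>v. f v - g v) \<in> I"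
  using poly_ideal_add[of B I f "\<lambda>v. (-1) * g v"] poly_ideal_mult[of B I "\<lambda>_. -1" g]
  by (simp add: poly_fun.const)

lemma poly_ideal_sum:
  "poly_ideal B I \<Longrightarrow> (\<And>i. i \<in> J \<Longrightarrow> f i \<in> I) \<Longrightarrow> (\<lambda>v. \<Sum>i\<in>J. f i v) \<in> I"
  by (induction J rule: infinite_finite_induct) (auto simp: poly_ideal_def)

lemma poly_ideal_const:
  assumes "poly_ideal B I" "(\<lambda>_. c) \<in> I" "c \<noteq> 0"
  shows "(\<lambda>_. 1) \<in> I"
  using poly_ideal_mult[OF assms(1) poly_fun.const[of "1 / c"] assms(2)] assms(3) by simp

text \<open>\<open>J\<close> is the ideal generated by \<open>I\<close> and \<open>g\<close>. If it
  contains 1 = i + h g, then \<open>g\<close> is invertible modulo \<open>I\<close>; so a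
  \<open>g\<close> without inverse modulo \<open>I\<close> can be adjoined and the ideal stays
  proper.\<close>

lemma poly_ideal_adjoin:
  assumes I: "poly_ideal B I" and g: "g \<in> poly_fun B"
  defines "J \<equiv> {\<lambda>v. i v + h v * g v |i h. i \<in> I \<and> h \<in> poly_fun B}"
  shows "poly_ideal B J" "I \<subseteq> J" "g \<in> J"
    "(\<lambda>_. 1) \<in> J \<Longrightarrow> \<exists>h\<in>poly_fun B. (\<lambda>v. 1 - h v * g v) \<in> I"
proof -
  have I0: "(\<lambda>_. 0) \<in> I" using I by (simp add: poly_ideal_def)
  show IJ: "I \<subseteq> J"
  proof
    fix f assume "f \<in> I"
    then show "f \<in> J"
      unfolding J_def using poly_fun.const[of 0 B]
      by (intro CollectI exI[of _ f] exI[of _ "\<lambda>_. 0"]) auto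
  qed
  show "g \<in> J"
    unfolding J_def using poly_fun.const[of 1 B] I0
    by (intro CollectI exI[of _ "\<lambda>_. 0"] exI[of _ "\<lambda>_. 1"]) auto
  show "poly_ideal B J"
    unfolding poly_ideal_def
  proof (intro conjI ballI)
    show "J \<subseteq> poly_fun B"
      unfolding J_def using I g by (auto simp: poly_ideal_def intro!: poly_fun.add poly_fun_mult)
    show "(\<lambda>_. 0) \<in> J" using IJ I0 by blast
  next
    fix p q assume "p \<in> J" "q \<in> J"
    then obtain i h j k where ih: "p = (\<lambda>v. i v + h v * g v)" "q = (\<lambda>v. j v + k v * g v)"
      "i \<in> I" "h \<in> poly_fun B" "j \<in> I" "k \<in> poly_fun B" unfolding J_def by blast
    show "(\<lambda>v. p v + q v) \<in> J"
      unfolding J_def using ih poly_ideal_add[OF I ih(3,5)] poly_fun.add[OF ih(4,6)]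
      by (intro CollectI exI[of _ "\<lambda>v. i v + j v"] exI[of _ "\<lambda>v. h v + k v"])
         (auto simp: algebra_simps)
  next
    fix p q assume p: "p \<in> poly_fun B" and "q \<in> J"
    then obtain j k where ih: "q = (\<lambda>v. j v + k v * g v)" "j \<in> I" "k \<in> poly_fun B"
      unfolding J_def by blast
    show "(\<lambda>v. p v * q v) \<in> J"
      unfolding J_def using ih poly_ideal_mult[OF I p ih(2)] poly_fun_mult[OF p ih(3)]
      by (intro CollectI exI[of _ "\<lambda>v. p v * j v"] exI[of _ "\<lambda>v. p v * k v"])
         (auto simp: algebra_simps)
  qed
  assume "(\<lambda>_. 1) \<in> J"
  then obtain i h where ih: "i \<in> I" "h \<in> poly_fun B" and eq: "(\<lambda>_. 1) = (\<lambda>v. i v + h v * g v)"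
    unfolding J_def by blast
  have "(\<lambda>v. 1 - h v * g v) = i"
  proof
    fix v show "1 - h v * g v = i v" using fun_cong[OF eq, of v] by (simp add: diff_eq_eq)
  qed
  with ih show "\<exists>h\<in>poly_fun B. (\<lambda>v. 1 - h v * g v) \<in> I" by auto
qed

text \<open>The space of polynomials has countable dimension, so uncountably many inverses of
  \<open>g - \<mu>\<close> modulo an ideal are linearly dependent; clearing denominators makes \<open>g\<close> algebraic.\<close>

lemma algebraic_of_uncountably_many_inverses:
  assumes B: "finite B" and U: "uncountable U" and I: "poly_ideal B I" and g: "g \<in> poly_fun B"
    and inv: "\<And>\<mu>. \<mu> \<in> U \<Longrightarrow> \<exists>h\<in>poly_fun B. (\<lambda>v. 1 - h v * (g v - \<mu>)) \<in> I"
  shows "\<exists>p. p \<noteq> 0 \<and> (\<lambda>v. poly p (g v)) \<in> I"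
proof -
  define inverse_of where "inverse_of \<mu> h L a \<longleftrightarrow> finite L \<and> L \<subseteq> lists B \<and>
      h = (\<lambda>v. \<Sum>l\<in>L. a l * prod_list (map v l)) \<and> (\<lambda>v. 1 - h v * (g v - \<mu>)) \<in> I"
    for \<mu> h L a
  have "\<exists>h L a. inverse_of \<mu> h L a" if "\<mu> \<in> U" for \<mu>
  proof -
    obtain h where h: "h \<in> poly_fun B" "(\<lambda>v. 1 - h v * (g v - \<mu>)) \<in> I"
      using inv[OF \<open>\<mu> \<in> U\<close>] by blast
    then show ?thesis
      using poly_fun_monomials[OF h(1)] unfolding inverse_of_def by blast
  qed
  then obtain h L a where hL: "\<And>\<mu>. \<mu> \<in> U \<Longrightarrow> inverse_of \<mu> (h \<mu>) (L \<mu>) (a \<mu>)"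
    by metis
  have L: "finite (L \<mu>)" "L \<mu> \<subseteq> lists B"
    and h: "h \<mu> = (\<lambda>v. \<Sum>l\<in>L \<mu>. a \<mu> l * prod_list (map v l))"
    and hI: "(\<lambda>v. 1 - h \<mu> v * (g v - \<mu>)) \<in> I" if "\<mu> \<in> U" for \<mu>
    using hL[OF that] unfolding inverse_of_def by blast+
  \<comment> \<open>Pigeonhole: there are only countably many finite sets of words, and the
    uncountable \<open>U\<close> is not a countable union of finite fibres.\<close>
  have "\<exists>M. infinite {\<mu> \<in> U. L \<mu> = M}"
  proof (rule ccontr)
    assume "\<not> ?thesis"
    moreover have "countable {M. finite M \<and> M \<subseteq> lists B}"
      using B by (intro countable_Collect_finite_subset countable_lists countable_finite)
    ultimately have "countable (\<Union>M\<in>{M. finite M \<and> M \<subseteq> lists B}. {\<mu> \<in> U. L \<mu> = M})"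
      by (intro countable_UN) (auto intro: countable_finite)
    moreover have "U \<subseteq> (\<Union>M\<in>{M. finite M \<and> M \<subseteq> lists B}. {\<mu> \<in> U. L \<mu> = M})"
      using L by auto
    ultimately show False using U countable_subset by blast
  qed
  then obtain M where M: "infinite {\<mu> \<in> U. L \<mu> = M}" by blast
  then have "{\<mu> \<in> U. L \<mu> = M} \<noteq> {}" by (metis finite.emptyI)
  then obtain \<mu>' where "\<mu>' \<in> U" "L \<mu>' = M" by blast
  then have "finite M" using L(1) by blast
  from nontrivial_linear_relation[OF this M, of a] obtain T c where
    T: "finite T" "T \<subseteq> {\<mu> \<in> U. L \<mu> = M}" "\<exists>\<mu>\<in>T. c \<mu> \<noteq> 0" and
    rel: "\<forall>l\<in>M. (\<Sum>\<mu>\<in>T. c \<mu> * a \<mu> l) = 0"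
    by blast
  \<comment> \<open>As all \<open>h \<mu>\<close> with \<open>\<mu>\<close> in \<open>T\<close> have
    the same support \<open>M\<close>, the relation between coefficients is one between
    functions.\<close>
  have h0: "(\<Sum>\<mu>\<in>T. c \<mu> * h \<mu> v) = 0" for v
  proof -
    have "(\<Sum>\<mu>\<in>T. c \<mu> * h \<mu> v) = (\<Sum>\<mu>\<in>T. \<Sum>l\<in>M. c \<mu> * a \<mu> l * prod_list (map v l))"
      using T(2) h by (intro sum.cong) (auto simp: sum_distrib_left mult.assoc)
    also have "\<dots> = (\<Sum>l\<in>M. (\<Sum>\<mu>\<in>T. c \<mu> * a \<mu> l) * prod_list (map v l))"
      by (subst sum.swap) (simp add: sum_distrib_right)
    finally show ?thesis using rel by simp
  qed
  \<comment> \<open>The sum of \<open>c \<mu> / (z - \<mu>)\<close> with denominators cleared. At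
    \<open>\<mu>\<^sub>0\<close> only the term of \<open>\<mu>\<^sub>0\<close> survives, so
    \<open>p\<close> is nonzero.\<close>
  define p where "p = (\<Sum>\<mu>\<in>T. smult (c \<mu>) (\<Prod>\<nu>\<in>T - {\<mu>}. [:- \<nu>, 1:]))"
  have p: "poly p z = (\<Sum>\<mu>\<in>T. c \<mu> * (\<Prod>\<nu>\<in>T - {\<mu>}. z - \<nu>))" for z
    by (simp add: p_def poly_sum poly_prod)
  obtain \<mu>\<^sub>0 where \<mu>\<^sub>0: "\<mu>\<^sub>0 \<in> T" "c \<mu>\<^sub>0 \<noteq> 0" using T(3) by blast
  have "poly p \<mu>\<^sub>0 = c \<mu>\<^sub>0 * (\<Prod>\<nu>\<in>T - {\<mu>\<^sub>0}. \<mu>\<^sub>0 - \<nu>)"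
    unfolding p using T(1) \<mu>\<^sub>0
    by (subst sum.remove[of _ \<mu>\<^sub>0]) (auto intro!: sum.neutral simp: prod_zero_iff)
  then have "p \<noteq> 0" using \<mu>\<^sub>0 T(1) by (auto simp: prod_zero_iff)
  moreover have "(\<lambda>v. poly p (g v)) \<in> I"
  proof -
    \<comment> \<open>The subtracted terms sum to the product of all \<open>g v - \<nu>\<close>
      times the vanishing sum \<open>h0\<close>. In the new form every summand lies in
      \<open>I\<close>.\<close>
    have "poly p (g v) =
        (\<Sum>\<mu>\<in>T. (c \<mu> * (\<Prod>\<nu>\<in>T - {\<mu>}. g v - \<nu>)) * (1 - h \<mu> v * (g v - \<mu>)))" for v
    proof -
      have "(\<Sum>\<mu>\<in>T. (c \<mu> * (\<Prod>\<nu>\<in>T - {\<mu>}. g v - \<nu>)) * (h \<mu> v * (g v - \<mu>)))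
          = (\<Sum>\<mu>\<in>T. c \<mu> * h \<mu> v * (\<Prod>\<nu>\<in>T. g v - \<nu>))"
        using T(1) by (intro sum.cong refl) (simp add: prod.remove mult_ac)
      also have "\<dots> = 0" using h0[of v] by (simp flip: sum_distrib_right)
      finally show ?thesis unfolding p by (simp add: right_diff_distrib sum_subtractf)
    qed
    moreover have "(\<lambda>v. \<Sum>\<mu>\<in>T. (c \<mu> * (\<Prod>\<nu>\<in>T - {\<mu>}. g v - \<nu>)) * (1 - h \<mu> v * (g v - \<mu>))) \<in> I"
      using T(2) hI g
      by (intro poly_ideal_sum[OF I] poly_ideal_mult[OF I])
         (auto intro!: poly_fun_cmult poly_fun_prod poly_fun_diff poly_fun.const)
    ultimately show ?thesis by simp
  qed
  ultimately show ?thesis by blast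
qed

section \<open>Weak Nullstellensatz and bounded polynomial functions\<close>

lemma poly_fun_poly: "g \<in> poly_fun B \<Longrightarrow> (\<lambda>v. poly p (g v)) \<in> poly_fun B"
  by (induction p) (auto intro!: poly_fun.const poly_fun.add poly_fun_mult)

text \<open>Over the complex numbers \<open>p\<close> splits into linear factors. Each factor
  \<open>g - z\<close> is invertible modulo \<open>I\<close> and can be cancelled, until a nonzero
  constant is left in \<open>I\<close>.\<close>

lemma poly_ideal_algebraic_inverses:
  assumes I: "poly_ideal B I" and g: "g \<in> poly_fun B"
    and inv: "\<And>\<mu>. \<exists>h\<in>poly_fun B. (\<lambda>v. 1 - h v * (g v - \<mu>)) \<in> I"
    and p: "p \<noteq> 0" "(\<lambda>v. poly p (g v)) \<in> I"
  shows "(\<lambda>_. 1) \<in> I"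
  using p
proof (induction "degree p" arbitrary: p)
  case 0
  then obtain c where "p = [:c:]" using degree_0_id by metis
  with 0 show ?case using poly_ideal_const[OF I, of c] by simp
next
  case (Suc m)
  have "\<not> constant (poly p)" using constant_degree[of p] Suc.hyps(2) by simp
  then obtain z where "poly p z = 0"
    using Fundamental_Theorem_Algebra.fundamental_theorem_of_algebra by blast
  then have "[:- z, 1:] dvd p" by (simp add: poly_eq_0_iff_dvd)
  then obtain q where q: "p = [:- z, 1:] * q" by (rule dvdE)
  with Suc.prems have "q \<noteq> 0" by auto
  with q Suc.hyps(2) have deg: "m = degree q" by (simp add: degree_mult_eq del: mult_pCons_left)
  obtain h where h: "h \<in> poly_fun B" "(\<lambda>v. 1 - h v * (g v - z)) \<in> I" using inv by blast
  \<comment> \<open>Multiplying \<open>p(g) = (g - z) q(g)\<close> by the inverse \<open>h\<close>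
    gives \<open>q(g)\<close> modulo \<open>I\<close>; the second summand makes this an exact
    equality.\<close>
  have "(\<lambda>v. h v * poly p (g v) + poly q (g v) * (1 - h v * (g v - z))) \<in> I"
    by (intro poly_ideal_add[OF I] poly_ideal_mult[OF I] h Suc.prems poly_fun_poly g)
  moreover have "h v * poly p (g v) + poly q (g v) * (1 - h v * (g v - z)) = poly q (g v)" for v
    by (simp add: q algebra_simps)
  ultimately have "(\<lambda>v. poly q (g v)) \<in> I" by simp
  with Suc.hyps(1)[OF deg \<open>q \<noteq> 0\<close>] show ?case .
qed

text \<open>If no \<open>\<mu>\<close> worked, every \<open>g - \<mu>\<close> would be invertible
  modulo \<open>I\<close>. Then \<open>g\<close> would be algebraic modulo \<open>I\<close>, and
  cancelling linear factors would put 1 into \<open>I\<close>.\<close>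

lemma proper_ideal_extend:
  assumes B: "finite B" and I: "poly_ideal B I" "(\<lambda>_. 1) \<notin> I" and g: "g \<in> poly_fun B"
  shows "\<exists>\<mu> J. poly_ideal B J \<and> (\<lambda>_. 1) \<notin> J \<and> I \<subseteq> J \<and> (\<lambda>v. g v - \<mu>) \<in> J"
proof (rule ccontr)
  assume contra: "\<not> ?thesis"
  have gm: "(\<lambda>v. g v - \<mu>) \<in> poly_fun B" for \<mu>
    by (intro poly_fun_diff g poly_fun.const)
  have inv: "\<exists>h\<in>poly_fun B. (\<lambda>v. 1 - h v * (g v - \<mu>)) \<in> I" for \<mu>
    using poly_ideal_adjoin[OF I(1) gm[of \<mu>]] contra by blast
  obtain p where "p \<noteq> 0" "(\<lambda>v. poly p (g v)) \<in> I"
    using algebraic_of_uncountably_many_inverses[OF B uncountable_UNIV_complex I(1) g inv] by blast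
  with I(2) show False using poly_ideal_algebraic_inverses[OF I(1) g inv, of p] by simp
qed

text \<open>The coordinates are specialised to constants \<open>w b\<close> one after another,
  keeping the ideal proper. In the end every polynomial function \<open>f\<close> is congruent to
  the constant \<open>f w\<close>, and for \<open>f\<close> in \<open>I\<close> this constant must
  vanish, as otherwise the ideal would contain 1.\<close>

lemma proper_ideal_point:
  assumes B: "finite B" and I: "poly_ideal B I" "(\<lambda>_. 1) \<notin> I"
  shows "\<exists>w. \<forall>f\<in>I. f w = 0"
proof -
  have "\<exists>w J. poly_ideal B J \<and> (\<lambda>_. 1) \<notin> J \<and> I \<subseteq> J \<and> (\<forall>b\<in>C. (\<lambda>v. v b - w b) \<in> J)"
    if "C \<subseteq> B" for C
    using finite_subset[OF that B] that
  proof (induction C rule: finite_induct)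
    case empty
    then show ?case using I by auto
  next
    case (insert b C)
    then obtain w J where J: "poly_ideal B J" "(\<lambda>_. 1) \<notin> J" "I \<subseteq> J" "\<forall>b\<in>C. (\<lambda>v. v b - w b) \<in> J"
      by blast
    have "(\<lambda>v. v b) \<in> poly_fun B" using insert.prems by (intro poly_fun_coord) auto
    from proper_ideal_extend[OF B J(1,2) this] obtain \<mu> J' where
      J': "poly_ideal B J'" "(\<lambda>_. 1) \<notin> J'" "J \<subseteq> J'" "(\<lambda>v. v b - \<mu>) \<in> J'" by blast
    show ?case
      using J J' insert.hyps(2) by (intro exI[of _ "w(b := \<mu>)"] exI[of _ J']) auto
  qed
  then obtain w J where J: "poly_ideal B J" "(\<lambda>_. 1) \<notin> J" "I \<subseteq> J"
    and w: "\<forall>b\<in>B. (\<lambda>v. v b - w b) \<in> J" by blast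
  have ev: "(\<lambda>v. f v - f w) \<in> J" if "f \<in> poly_fun B" for f
    using that
  proof (induction rule: poly_fun.induct)
    case (const c)
    then show ?case using J(1) by (simp add: poly_ideal_def)
  next
    case (add f g)
    then show ?case using poly_ideal_add[OF J(1) add.IH] by (simp add: algebra_simps)
  next
    case (coord_mult b f)
    have "(\<lambda>v. f v * (v b - w b) + w b * (f v - f w)) \<in> J"
      using w coord_mult
      by (intro poly_ideal_add[OF J(1)] poly_ideal_mult[OF J(1)] poly_fun.const) auto
    then show ?case by (simp add: algebra_simps)
  qed
  have "f w = 0" if "f \<in> I" for f
  proof (rule ccontr)
    assume "f w \<noteq> 0"
    have "f \<in> poly_fun B" using that I(1) by (auto simp: poly_ideal_def)
    then have "(\<lambda>v. f v - (f v - f w)) \<in> J"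
      using that J(1,3) ev poly_ideal_diff[of B J f "\<lambda>v. f v - f w"] by blast
    with poly_ideal_const[OF J(1) _ \<open>f w \<noteq> 0\<close>] J(2) show False by simp
  qed
  then show ?thesis by blast
qed

text \<open>A value \<open>\<mu>\<close> outside the disc of radius \<open>R\<close> is never
  attained on the zero set, so by the Nullstellensatz \<open>f - \<mu>\<close> is invertible modulo
  its vanishing ideal. There are uncountably many such \<open>\<mu>\<close>, hence
  \<open>p(f)\<close> vanishes on the zero set for some nonzero \<open>p\<close>, and the values of
  \<open>f\<close> are roots of \<open>p\<close>.\<close>

lemma bounded_poly_fun_finite_image:
  assumes B: "finite B" and E: "E \<subseteq> poly_fun B" and f: "f \<in> poly_fun B"
    and bdd: "\<And>v. (\<forall>e\<in>E. e v = 0) \<Longrightarrow> norm (f v) \<le> R"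
  shows "finite (f ` {v. \<forall>e\<in>E. e v = 0})"
proof -
  define S where "S = {v. \<forall>e\<in>E. e v = 0}"
  define I where "I = {e \<in> poly_fun B. \<forall>v\<in>S. e v = 0}"
  have I: "poly_ideal B I"
    by (auto simp: poly_ideal_def I_def intro: poly_fun.const poly_fun.add poly_fun_mult)
  have EI: "E \<subseteq> I" using E by (auto simp: I_def S_def)
  have fm: "(\<lambda>v. f v - \<mu>) \<in> poly_fun B" for \<mu>
    by (intro poly_fun_diff f poly_fun.const)
  have inv: "\<exists>h\<in>poly_fun B. (\<lambda>v. 1 - h v * (f v - \<mu>)) \<in> I" if "\<mu> \<in> - cball 0 R" for \<mu>
  proof (rule ccontr)
    assume no_inv: "\<not> ?thesis"
    obtain J where J: "poly_ideal B J" "I \<subseteq> J" "(\<lambda>v. f v - \<mu>) \<in> J" "(\<lambda>_. 1) \<notin> J"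
      using poly_ideal_adjoin[OF I fm[of \<mu>]] no_inv by blast
    obtain w where "\<forall>e\<in>J. e w = 0" using proper_ideal_point[OF B J(1,4)] by blast
    then have "\<forall>e\<in>E. e w = 0" "f w = \<mu>" using EI J by auto
    with bdd[of w] that show False by simp
  qed
  have "uncountable (- cball 0 R :: complex set)"
  proof -
    \<comment> \<open>The absolute value covers negative \<open>R\<close> as well.\<close>
    have "{z. Im z > \<bar>R\<bar>} \<subseteq> - cball 0 R"
      using abs_Im_le_cmod order.trans by (fastforce simp: not_le)
    then show ?thesis using uncountable_halfspace_Im_gt countable_subset by blast
  qed
  from algebraic_of_uncountably_many_inverses[OF B this I f inv] obtain p where
    p: "p \<noteq> 0" "(\<lambda>v. poly p (f v)) \<in> I" by blast
  then have "f ` S \<subseteq> {z. poly p z = 0}" by (auto simp: I_def)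
  then show ?thesis
    unfolding S_def using poly_roots_finite[OF p(1)] finite_subset by blast
qed

text \<open>The restrictions to \<open>X\<close> span a finite-dimensional space, so finitely many
  evaluations separate its elements. Each further function \<open>e b\<close> costs at most one
  further point.\<close>

lemma finite_determining_set:
  fixes e :: "'b \<Rightarrow> 'x \<Rightarrow> 'k::field"
  assumes "finite B"
  shows "\<exists>T. finite T \<and> T \<subseteq> X \<and> (\<forall>c. (\<forall>x\<in>T. (\<Sum>b\<in>B. c b * e b x) = 0) \<longrightarrow>
    (\<forall>x\<in>X. (\<Sum>b\<in>B. c b * e b x) = 0))"
  using assms
proof (induction B rule: finite_induct)
  case empty
  then show ?case by auto
next
  case (insert b B)
  define ev where "ev c x = (\<Sum>b\<in>B. c b * e b x)" for c x
  obtain T where T: "finite T" "T \<subseteq> X" and det: "\<And>c x. \<forall>x\<in>T. ev c x = 0 \<Longrightarrow> x \<in> X \<Longrightarrow> ev c x = 0"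
    using insert.IH unfolding ev_def by blast
  have sum: "(\<Sum>b\<in>insert b B. c b * e b x) = c b * e b x + ev c x" for c x
    using insert.hyps by (simp add: ev_def)
  show ?case
  proof (cases "\<exists>c. (\<forall>x\<in>T. c b * e b x + ev c x = 0) \<and> (\<exists>x\<in>X. c b * e b x + ev c x \<noteq> 0)")
    case False
    with T show ?thesis unfolding sum by blast
  next
    case True
    then obtain c x\<^sub>0 where c: "\<forall>x\<in>T. c b * e b x + ev c x = 0" "x\<^sub>0 \<in> X"
      "c b * e b x\<^sub>0 + ev c x\<^sub>0 \<noteq> 0" by blast
    have cb: "c b \<noteq> 0"
    proof
      assume "c b = 0"
      with c det[of c x\<^sub>0] show False by simp
    qed
    have "c' b * e b x + ev c' x = 0"
      if c': "\<forall>x\<in>insert x\<^sub>0 T. c' b * e b x + ev c' x = 0" and x: "x \<in> X" for c' x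
    proof -
      \<comment> \<open>Subtracting \<open>t\<close> times the witness \<open>c\<close> removes the
        coefficient at \<open>b\<close>, so the induction hypothesis applies to the difference
        \<open>u\<close>. Evaluation at \<open>x\<^sub>0\<close> then forces
        \<open>t = 0\<close>.\<close>
      define t where "t = c' b / c b"
      have tc: "c' b = t * c b" using cb by (simp add: t_def)
      define u where "u j = c' j - t * c j" for j
      have u: "ev u x = (c' b * e b x + ev c' x) - t * (c b * e b x + ev c x)" for x
        by (simp add: u_def ev_def tc algebra_simps sum_subtractf sum_distrib_left)
      have u0: "ev u x = 0" if "x \<in> X" for x
        using det[of u, OF _ that] c(1) c' u by simp
      have "t = 0" using u[of x\<^sub>0] u0[OF c(2)] c' c(3) by simp
      then show ?thesis using u[of x] u0[OF x] by simp
    qed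
    moreover have "finite (insert x\<^sub>0 T)" "insert x\<^sub>0 T \<subseteq> X" using T c(2) by simp_all
    ultimately show ?thesis
      unfolding sum by blast
  qed
qed

section \<open>Homogeneous polynomial maps\<close>

definition monomial_value :: "('n::finite \<Rightarrow> nat) \<Rightarrow> complex ^ 'n \<Rightarrow> complex" where
  "monomial_value \<alpha> x = (\<Prod>i\<in>UNIV. (x $ i) ^ \<alpha> i)"

text \<open>All coefficients are gathered in one argument \<open>v\<close>, so that the map can be
  read as a polynomial in \<open>x\<close> or as a linear function of the point \<open>v\<close> of
  an affine space.\<close>

definition form_map ::
    "nat \<Rightarrow> ('n \<times> ('n \<Rightarrow> nat) \<Rightarrow> complex) \<Rightarrow> complex ^ 'n::finite \<Rightarrow> complex ^ 'n" where
  "form_map d v x = (\<chi> i. \<Sum>\<alpha>\<in>{\<alpha>. (\<Sum>j\<in>UNIV. \<alpha> j) = d}. v (i, \<alpha>) * monomial_value \<alpha> x)"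

lemma form_map_nth:
  "form_map d v x $ i = (\<Sum>\<alpha>\<in>{\<alpha>. (\<Sum>j\<in>UNIV. \<alpha> j) = d}. v (i, \<alpha>) * monomial_value \<alpha> x)"
  by (simp add: form_map_def)

lemma endomorphism_of_degree_iff:
  fixes \<phi> :: "'n::finite proj_space \<Rightarrow> 'n proj_space"
  shows "endomorphism_of_degree d \<phi> \<longleftrightarrow> (\<exists>v. (\<forall>x. form_map d v x = 0 \<longrightarrow> x = 0) \<and>
    (\<forall>x. x \<noteq> 0 \<longrightarrow> \<phi> (proj_point x) = proj_point (form_map d v x)))"
proof
  assume "endomorphism_of_degree d \<phi>"
  then obtain F where F: "\<forall>i. homogeneous_form d (F i)" "\<forall>x. (\<forall>i. F i x = 0) \<longrightarrow> x = 0"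
    "\<forall>x. x \<noteq> 0 \<longrightarrow> \<phi> (proj_point x) = proj_point (\<chi> i. F i x)"
    unfolding endomorphism_of_degree_def by blast
  have "\<exists>c. F i = (\<lambda>x. \<Sum>\<alpha>\<in>{\<alpha>. (\<Sum>j\<in>UNIV. \<alpha> j) = d}. c \<alpha> * monomial_value \<alpha> x)" for i
    using F(1) unfolding homogeneous_form_def monomial_value_def by blast
  then obtain c where c: "\<And>i. F i = (\<lambda>x. \<Sum>\<alpha>\<in>{\<alpha>. (\<Sum>j\<in>UNIV. \<alpha> j) = d}. c i \<alpha> * monomial_value \<alpha> x)"
    by metis
  have eq: "form_map d (\<lambda>(i, \<alpha>). c i \<alpha>) x = (\<chi> i. F i x)" for x
    by (simp add: vec_eq_iff form_map_nth c)
  have "x = 0" if "form_map d (\<lambda>(i, \<alpha>). c i \<alpha>) x = 0" for x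
    using that F(2) unfolding eq by (simp add: vec_eq_iff)
  with F(3) show "\<exists>v. (\<forall>x. form_map d v x = 0 \<longrightarrow> x = 0) \<and>
    (\<forall>x. x \<noteq> 0 \<longrightarrow> \<phi> (proj_point x) = proj_point (form_map d v x))"
    by (intro exI[of _ "\<lambda>(i, \<alpha>). c i \<alpha>"]) (simp add: eq)
next
  assume "\<exists>v. (\<forall>x. form_map d v x = 0 \<longrightarrow> x = 0) \<and>
    (\<forall>x. x \<noteq> 0 \<longrightarrow> \<phi> (proj_point x) = proj_point (form_map d v x))"
  then obtain v where v: "\<And>x. form_map d v x = 0 \<Longrightarrow> x = 0"
    "\<And>x. x \<noteq> 0 \<Longrightarrow> \<phi> (proj_point x) = proj_point (form_map d v x)" by blast
  have "homogeneous_form d (\<lambda>x. form_map d v x $ i)" for i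
    unfolding homogeneous_form_def form_map_nth monomial_value_def
    by (rule exI[of _ "\<lambda>\<alpha>. v (i, \<alpha>)"]) simp
  moreover have "(\<chi> i. form_map d v x $ i) = form_map d v x" for x
    by (rule vec_nth_inverse)
  moreover have "x = 0" if "\<forall>i. form_map d v x $ i = 0" for x
    by (rule v(1)) (use that in \<open>simp add: vec_eq_iff\<close>)
  ultimately show "endomorphism_of_degree d \<phi>"
    unfolding endomorphism_of_degree_def using v(2)
    by (intro exI[of _ "\<lambda>i x. form_map d v x $ i"]) simp
qed

lemma monomial_value_smult: "monomial_value \<alpha> (c *s x) = c ^ (\<Sum>j\<in>UNIV. \<alpha> j) * monomial_value \<alpha> x"
  by (simp add: monomial_value_def power_mult_distrib prod.distrib power_sum)

lemma form_map_smult: "form_map d v (c *s x) = c ^ d *s form_map d v x"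
  by (auto simp: vec_eq_iff form_map_nth sum_distrib_left mult.left_commute monomial_value_smult
    intro!: sum.cong)

lemma form_map_scale_coeffs: "form_map d (\<lambda>b. t * v b) x = t *s form_map d v x"
  by (simp add: vec_eq_iff form_map_nth sum_distrib_left mult.assoc)

section \<open>Continuity, holomorphy and growth of homogeneous maps\<close>

lemma continuous_form_map: "continuous_on UNIV (form_map d v)"
  unfolding form_map_def monomial_value_def
  by (intro continuous_on_vec_lambda continuous_intros)

lemma holomorphic_form_map:
  assumes "\<And>j. (\<lambda>z. X z $ j) holomorphic_on A"
  shows "(\<lambda>z. form_map d v (X z) $ i) holomorphic_on A"
  unfolding form_map_nth monomial_value_def by (intro holomorphic_intros assms)

lemma form_map_0: "d \<ge> 1 \<Longrightarrow> form_map d v 0 = 0"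
  using form_map_smult[of d v 0 0] by (simp add: power_0_left)

lemma norm_smult_vec: "norm (c *s x) = norm c * norm (x :: complex ^ 'n)"
  by (simp add: norm_vec_def norm_mult L2_set_left_distrib[symmetric] L2_set_right_distrib)

lemma unit_vector_decomposition:
  fixes x :: "complex ^ 'n"
  assumes "x \<noteq> 0"
  obtains u where "norm u = 1" "x = of_real (norm x) *s u"
proof
  show "norm (of_real (1 / norm x) *s x) = 1"
    unfolding norm_smult_vec norm_of_real using assms by simp
  show "x = of_real (norm x) *s (of_real (1 / norm x) *s x)"
    using assms by (simp add: vec_eq_iff)
qed

text \<open>The norm is bounded on the compact unit sphere; homogeneity carries the bound to all
  vectors.\<close>

lemma form_map_upper_bound:
  fixes v :: "'n::finite \<times> ('n \<Rightarrow> nat) \<Rightarrow> complex"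
  assumes "d \<ge> 1"
  shows "\<exists>C>0. \<forall>x. norm (form_map d v x) \<le> C * norm x ^ d"
proof -
  have "compact (form_map d v ` sphere 0 1)"
    by (intro compact_continuous_image compact_sphere continuous_on_subset[OF continuous_form_map]) simp
  then obtain C where C: "C > 0" "\<And>u. norm u = 1 \<Longrightarrow> norm (form_map d v u) \<le> C"
    using compact_imp_bounded bounded_pos[of "form_map d v ` sphere 0 1"] by auto
  have "norm (form_map d v x) \<le> C * norm x ^ d" for x
  proof (cases "x = 0")
    case True
    with assms show ?thesis by (simp add: form_map_0 power_0_left)
  next
    case False
    then obtain u where u: "norm u = 1" "x = of_real (norm x) *s u"
      by (rule unit_vector_decomposition)
    have "norm (form_map d v x) = norm x ^ d * norm (form_map d v u)"
      by (subst u(2)) (simp add: form_map_smult norm_smult_vec norm_power)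
    with mult_left_mono[OF C(2)[OF u(1)], of "norm x ^ d"] show ?thesis
      by (simp add: mult.commute)
  qed
  with C(1) show ?thesis by blast
qed

text \<open>The minimum of the norm on the unit sphere is attained, and it is positive because the
  only zero is the origin.\<close>

lemma form_map_lower_bound:
  fixes v :: "'n::finite \<times> ('n \<Rightarrow> nat) \<Rightarrow> complex"
  assumes "d \<ge> 1" and nz: "\<And>x. form_map d v x = 0 \<Longrightarrow> x = 0"
  shows "\<exists>c>0. \<forall>x. c * norm x ^ d \<le> norm (form_map d v x)"
proof -
  have "axis undefined 1 \<in> (sphere 0 1 :: (complex ^ 'n) set)" by simp
  then have "sphere 0 1 \<noteq> ({} :: (complex ^ 'n) set)" by blast
  moreover have "continuous_on (sphere 0 1) (\<lambda>x. norm (form_map d v x))"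
    by (intro continuous_on_norm continuous_on_subset[OF continuous_form_map]) simp
  ultimately obtain w where w: "w \<in> sphere 0 1"
    "\<And>u. u \<in> sphere 0 1 \<Longrightarrow> norm (form_map d v w) \<le> norm (form_map d v u)"
    using continuous_attains_inf[OF compact_sphere, of 0 1 "\<lambda>x. norm (form_map d v x)"] by blast
  define c where "c = norm (form_map d v w)"
  have "c > 0" using w(1) nz[of w] by (auto simp: c_def)
  moreover have "c * norm x ^ d \<le> norm (form_map d v x)" for x
  proof (cases "x = 0")
    case True
    with assms show ?thesis by (simp add: form_map_0 power_0_left)
  next
    case False
    then obtain u where u: "norm u = 1" "x = of_real (norm x) *s u"
      by (rule unit_vector_decomposition)
    have "norm (form_map d v x) = norm x ^ d * norm (form_map d v u)"
      by (subst u(2)) (simp add: form_map_smult norm_smult_vec norm_power)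
    with mult_left_mono[OF w(2)[of u], of "norm x ^ d"] u(1) show ?thesis
      by (simp add: c_def mult.commute)
  qed
  ultimately show ?thesis by blast
qed

section \<open>Lifts that commute exactly\<close>

text \<open>The scalar is constant along every line that misses the origin, where it is a bounded entire
  function.\<close>

lemma proportionality_constant:
  fixes P Q :: "complex ^ 'n \<Rightarrow> complex ^ 'n"
  assumes hom: "\<And>t x. P (t *s x) = t ^ e *s P x" "\<And>t x. Q (t *s x) = t ^ e *s Q x"
    and hol: "\<And>a b i. (\<lambda>z. P (a + z *s b) $ i) holomorphic_on UNIV"
      "\<And>a b i. (\<lambda>z. Q (a + z *s b) $ i) holomorphic_on UNIV"
    and upper: "\<And>x. norm (P x) \<le> C * norm x ^ e"
    and lower: "c > 0" "\<And>x. c * norm x ^ e \<le> norm (Q x)"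
    and ratio: "\<And>x. x \<noteq> 0 \<Longrightarrow> \<exists>s. P x = s *s Q x"
  shows "\<exists>s. \<forall>x. x \<noteq> 0 \<longrightarrow> P x = s *s Q x"
proof -
  obtain r where r: "\<And>x. x \<noteq> 0 \<Longrightarrow> P x = r x *s Q x" using ratio by metis
  have Q0: "Q x \<noteq> 0" if "x \<noteq> 0" for x
  proof
    assume "Q x = 0"
    with lower(2)[of x] have "c * norm x ^ e \<le> 0" by simp
    moreover have "0 < c * norm x ^ e" using lower(1) that by simp
    ultimately show False by linarith
  qed
  have uniq: "s = s'" if "x \<noteq> 0" "s *s Q x = s' *s Q x" for s s' x
    using Q0[OF that(1)] that(2) by (simp add: vector_mul_rcancel)
  have bound: "norm (r x) \<le> C / c" if "x \<noteq> 0" for x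
  proof -
    have "norm (r x) * (c * norm x ^ e) \<le> norm (r x) * norm (Q x)"
      by (intro mult_left_mono lower(2)) simp
    also have "\<dots> = norm (P x)" by (simp add: r[OF that] norm_smult_vec)
    also have "\<dots> \<le> C * norm x ^ e" by (rule upper)
    finally have "norm x ^ e * (norm (r x) * c) \<le> norm x ^ e * C" by (simp add: mult_ac)
    then show ?thesis using that lower(1) by (simp add: field_simps)
  qed
  have const: "r x = r y" if x: "x \<noteq> 0" and y: "y \<noteq> 0" for x y
  proof (cases "\<exists>z. x + z *s (y - x) = 0")
    case True
    then obtain z where z: "x + z *s (y - x) = 0" by blast
    with x have "z \<noteq> 0" by auto
    \<comment> \<open>The line through \<open>x\<close> and \<open>y\<close> contains the origin, so
      \<open>y\<close> is a multiple of \<open>x\<close>. As \<open>P\<close> and \<open>Q\<close>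
      scale by the same power, the ratio is the same at both points.\<close>
    have yx: "y = (1 - 1 / z) *s x"
    proof (subst vec_eq_iff, rule allI)
      fix i
      have "x $ i + z * (y $ i - x $ i) = 0" using z by (simp add: vec_eq_iff right_diff_distrib)
      with \<open>z \<noteq> 0\<close> show "y $ i = ((1 - 1 / z) *s x) $ i" by (simp add: field_simps)
    qed
    define t where "t = 1 - 1 / z"
    have tx: "y = t *s x" using yx by (simp only: t_def)
    then have "t \<noteq> 0" using y by auto
    have "(t ^ e * r x) *s Q x = P (t *s x)"
      by (simp add: hom(1) r[OF x] vector_smult_assoc)
    also have "\<dots> = (t ^ e * r (t *s x)) *s Q x"
      using r[of "t *s x"] y unfolding tx by (simp add: hom(2) vector_smult_assoc mult.commute)
    finally have "t ^ e * r x = t ^ e * r (t *s x)" using uniq[OF x] by blast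
    with \<open>t \<noteq> 0\<close> show ?thesis by (simp add: tx)
  next
    case False
    define L where "L z = x + z *s (y - x)" for z
    have L0: "L z \<noteq> 0" for z using False by (simp add: L_def)
    have "(\<lambda>z. r (L z)) holomorphic_on UNIV"
    proof (rule holomorphic_onI)
      fix z
      obtain i where i: "Q (L z) $ i \<noteq> 0" using Q0[OF L0[of z]] by (auto simp: vec_eq_iff)
      \<comment> \<open>Near \<open>z\<close> the ratio is a quotient of entire functions whose
        denominator does not vanish. The index \<open>i\<close> depends on \<open>z\<close>, so
        holomorphy is proved point by point.\<close>
      define S where "S = {z. Q (L z) $ i \<noteq> 0}"
      have S: "open S"
        unfolding S_def L_def
        by (intro open_Collect_neq continuous_on_const holomorphic_on_imp_continuous_on[OF hol(2)])
      have "(\<lambda>z. P (L z) $ i / Q (L z) $ i) holomorphic_on S"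
        unfolding L_def by (intro holomorphic_on_divide holomorphic_on_subset[OF hol(1)]
          holomorphic_on_subset[OF hol(2)]) (auto simp: S_def L_def)
      then have "(\<lambda>z. r (L z)) holomorphic_on S"
        by (rule holomorphic_transform) (auto simp: S_def r[OF L0])
      then show "(\<lambda>z. r (L z)) field_differentiable at z"
        using S i by (intro holomorphic_on_imp_differentiable_at) (auto simp: S_def)
    qed
    moreover have "bounded (range (\<lambda>z. r (L z)))"
      using bound[OF L0] by (auto intro!: boundedI)
    ultimately have "(\<lambda>z. r (L z)) constant_on UNIV" by (rule Liouville_theorem)
    then have "r (L 0) = r (L 1)" by (auto simp: constant_on_def)
    then show ?thesis by (simp add: L_def)
  qed
  have "P x = r (axis undefined 1) *s Q x" if "x \<noteq> 0" for x
    using r[OF that] const[OF that, of "axis undefined 1"] by simp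
  then show ?thesis by blast
qed

text \<open>For any lift the two composites are proportional at each point, hence with one constant
  \<open>s\<close>. Replacing the lift by \<open>t\<close> times itself multiplies one composite by
  \<open>t\<close> and the other by \<open>t ^ k\<close>, so a root of
  \<open>s = t ^ (k - 1)\<close> makes them equal.\<close>

lemma commuting_lift:
  fixes \<phi> \<psi> :: "'n::finite proj_space \<Rightarrow> 'n proj_space"
  assumes k: "k \<ge> 2" and d: "d \<ge> 1"
    and u: "\<And>x. form_map k u x = 0 \<Longrightarrow> x = 0"
      "\<And>x. x \<noteq> 0 \<Longrightarrow> \<phi> (proj_point x) = proj_point (form_map k u x)"
    and \<psi>: "\<psi> \<in> Com \<phi> d"
  shows "\<exists>v. (\<forall>x. form_map d v (form_map k u x) = form_map k u (form_map d v x)) \<and>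
    (\<forall>x. form_map d v x = 0 \<longrightarrow> x = 0) \<and>
    (\<forall>x. x \<noteq> 0 \<longrightarrow> \<psi> (proj_point x) = proj_point (form_map d v x))"
proof -
  obtain v where v: "\<And>x. form_map d v x = 0 \<Longrightarrow> x = 0"
      "\<And>x. x \<noteq> 0 \<Longrightarrow> \<psi> (proj_point x) = proj_point (form_map d v x)"
    using \<psi> unfolding Com_def endomorphism_of_degree_iff by auto
  have comm: "\<psi> (\<phi> p) = \<phi> (\<psi> p)" for p using \<psi> by (auto simp: Com_def fun_eq_iff)
  define P where "P x = form_map d v (form_map k u x)" for x
  define Q where "Q x = form_map k u (form_map d v x)" for x
  have ratio: "\<exists>s. s \<noteq> 0 \<and> P x = s *s Q x" if "x \<noteq> 0" for x
  proof -
    have nz: "form_map k u x \<noteq> 0" "form_map d v x \<noteq> 0" "P x \<noteq> 0" "Q x \<noteq> 0"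
      using u(1) v(1) that unfolding P_def Q_def by blast+
    have "proj_point (P x) = proj_point (Q x)"
      using comm[of "proj_point x"] nz that by (simp add: u(2) v(2) P_def Q_def)
    then show ?thesis using proj_point_eq_iff nz(3,4) by blast
  qed
  obtain C1 where C1: "C1 > 0" "\<And>x. norm (form_map d v x) \<le> C1 * norm x ^ d"
    using form_map_upper_bound[OF d] by blast
  obtain C2 where C2: "C2 > 0" "\<And>x. norm (form_map k u x) \<le> C2 * norm x ^ k"
    using form_map_upper_bound[of k u] k by auto
  obtain c1 where c1: "c1 > 0" "\<And>x. c1 * norm x ^ d \<le> norm (form_map d v x)"
    using form_map_lower_bound[OF d v(1)] by blast
  obtain c2 where c2: "c2 > 0" "\<And>x. c2 * norm x ^ k \<le> norm (form_map k u x)"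
    using form_map_lower_bound[of k u] k u(1) by auto
  have upper: "norm (P x) \<le> (C1 * C2 ^ d) * norm x ^ (k * d)" for x
  proof -
    have "norm (P x) \<le> C1 * norm (form_map k u x) ^ d" unfolding P_def by (rule C1(2))
    also have "\<dots> \<le> C1 * (C2 * norm x ^ k) ^ d"
      using C1(1) C2(2) by (intro mult_left_mono power_mono) auto
    finally show ?thesis by (simp add: power_mult_distrib power_mult mult.assoc)
  qed
  have lower: "(c2 * c1 ^ k) * norm x ^ (k * d) \<le> norm (Q x)" for x
  proof -
    have "c2 * (c1 * norm x ^ d) ^ k \<le> c2 * norm (form_map d v x) ^ k"
      using c1 c2(1) by (intro mult_left_mono power_mono) auto
    also have "\<dots> \<le> norm (Q x)" unfolding Q_def by (rule c2(2))
    finally show ?thesis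
      by (simp add: power_mult_distrib mult.assoc mult.commute[of k d] flip: power_mult)
  qed
  have line: "(\<lambda>z. (a + z *s b) $ j) holomorphic_on UNIV" for a b :: "complex ^ 'n" and j
    by (auto intro!: holomorphic_intros)
  have "\<exists>s. \<forall>x. x \<noteq> 0 \<longrightarrow> P x = s *s Q x"
  proof (rule proportionality_constant[where e = "k * d"])
    show "P (t *s x) = t ^ (k * d) *s P x" "Q (t *s x) = t ^ (k * d) *s Q x" for t x
      by (simp_all add: P_def Q_def form_map_smult mult.commute[of k d] flip: power_mult)
    show "(\<lambda>z. P (a + z *s b) $ i) holomorphic_on UNIV"
      "(\<lambda>z. Q (a + z *s b) $ i) holomorphic_on UNIV" for a b i
      unfolding P_def Q_def by (intro holomorphic_form_map line)+
    show "norm (P x) \<le> (C1 * C2 ^ d) * norm x ^ (k * d)" for x by (rule upper)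
    show "(c2 * c1 ^ k) * norm x ^ (k * d) \<le> norm (Q x)" for x by (rule lower)
    show "c2 * c1 ^ k > 0" using c1(1) c2(1) by simp
    show "\<exists>s. P x = s *s Q x" if "x \<noteq> 0" for x using ratio[OF that] by blast
  qed
  then obtain s where s: "\<And>x. x \<noteq> 0 \<Longrightarrow> P x = s *s Q x" by blast
  have "axis undefined 1 \<noteq> (0 :: complex ^ 'n)" by simp
  then have "P (axis undefined 1) \<noteq> 0" using u(1) v(1) unfolding P_def by blast
  with s[of "axis undefined 1"] have "s \<noteq> 0" by auto
  \<comment> \<open>Here \<open>k \<ge> 2\<close> enters: the exponent \<open>k - 1\<close> is
    positive, so the root exists.\<close>
  with k obtain t where t: "t \<noteq> 0" "s = t ^ (k - 1)"
    using exists_complex_root_nonzero[of s "k - 1"] by auto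
  define w where "w = (\<lambda>b. t * v b)"
  have w: "form_map d w x = t *s form_map d v x" for x
    unfolding w_def by (rule form_map_scale_coeffs)
  have "form_map d w (form_map k u x) = form_map k u (form_map d w x)" for x
  proof (cases "x = 0")
    case True
    then show ?thesis using k d by (simp add: form_map_0)
  next
    case False
    have "t * s = t ^ k" using k by (simp add: t(2) flip: power_Suc)
    with s[OF False] show ?thesis
      by (simp add: w form_map_smult P_def Q_def vector_smult_assoc)
  qed
  moreover have "x = 0" if "form_map d w x = 0" for x
    using that t(1) v(1) by (simp add: w vector_mul_eq_0)
  moreover have "\<psi> (proj_point x) = proj_point (form_map d w x)" if "x \<noteq> 0" for x
  proof -
    have "form_map d v x \<noteq> 0" "form_map d w x \<noteq> 0" using that v(1) t(1) by (auto simp: w)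
    then have "proj_point (form_map d w x) = proj_point (form_map d v x)"
      using t(1) w by (auto simp: proj_point_eq_iff)
    with v(2)[OF that] show ?thesis by simp
  qed
  ultimately show ?thesis by blast
qed

section \<open>Bounded orbits\<close>

text \<open>Points with bounded orbit under \<open>form_map k u\<close> form a bounded neighbourhood of the origin,
  and every commuting map preserves this set.\<close>

lemma commuting_form_maps_bounded:
  fixes u :: "'n::finite \<times> ('n \<Rightarrow> nat) \<Rightarrow> complex"
  assumes k: "k \<ge> 2" and d: "d \<ge> 1" and u: "\<And>x. form_map k u x = 0 \<Longrightarrow> x = 0"
  shows "\<exists>r>0. \<exists>R. \<forall>v x.
    (\<forall>y. form_map d v (form_map k u y) = form_map k u (form_map d v y)) \<longrightarrow> norm x \<le> r \<longrightarrow>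
      norm (form_map d v x) \<le> R"
proof -
  let ?\<Phi> = "form_map k u"
  obtain C where C: "C > 0" "\<And>x. norm (?\<Phi> x) \<le> C * norm x ^ k"
    using form_map_upper_bound[of k u] k by auto
  obtain c where c: "c > 0" "\<And>x. c * norm x ^ k \<le> norm (?\<Phi> x)"
    using form_map_lower_bound[of k u] k u by auto
  \<comment> \<open>Chosen so that the ball of radius \<open>r\<close> is mapped into itself:
    \<open>C * r ^ 2 \<le> r\<close>, and \<open>k \<ge> 2\<close>.\<close>
  define r where "r = min 1 (1 / C)"
  \<comment> \<open>Chosen so that outside radius \<open>R\<close> each application at least doubles
    the norm.\<close>
  define R where "R = max 1 (2 / c)"
  have r: "r > 0" "r \<le> 1" "C * r \<le> 1" using C(1) by (auto simp: r_def field_simps min_def)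
  have small: "norm (?\<Phi> x) \<le> r" if "norm x \<le> r" for x
  proof -
    have "norm x ^ k \<le> norm x ^ 2" using k that r by (intro power_decreasing) auto
    also have "\<dots> \<le> r ^ 2" using that by (intro power_mono) auto
    finally have "C * norm x ^ k \<le> C * r ^ 2" using C(1) by simp
    also have "\<dots> = (C * r) * r" by (simp add: power2_eq_square)
    also have "\<dots> \<le> 1 * r" using r by (intro mult_right_mono) auto
    finally show ?thesis using C(2)[of x] by simp
  qed
  have large: "2 * norm y \<le> norm (?\<Phi> y)" if "norm y > R" for y
  proof -
    have y: "norm y \<ge> 1" "2 / c \<le> norm y" using that by (auto simp: R_def)
    then have "2 \<le> c * norm y" using c(1) by (simp add: field_simps)
    then have "2 * norm y \<le> (c * norm y) * norm y" by (intro mult_right_mono) auto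
    also have "\<dots> = c * norm y ^ 2" by (simp add: power2_eq_square)
    also have "\<dots> \<le> c * norm y ^ k"
      using c(1) k y(1) by (intro mult_left_mono power_increasing) auto
    finally show ?thesis using c(2)[of y] by simp
  qed
  have "norm (form_map d v x) \<le> R"
    if comm: "\<forall>y. form_map d v (?\<Phi> y) = ?\<Phi> (form_map d v y)" and x: "norm x \<le> r" for v x
  proof (rule ccontr)
    assume "\<not> norm (form_map d v x) \<le> R"
    then have big: "norm (form_map d v x) > R" by simp
    \<comment> \<open>\<open>D\<close> depends on \<open>v\<close> and serves only to bound the
      image of the small ball; \<open>r\<close> and \<open>R\<close> come from \<open>u\<close>
      alone, which makes the final bound uniform.\<close>
    obtain D where D: "D > 0" "\<And>x. norm (form_map d v x) \<le> D * norm x ^ d"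
      using form_map_upper_bound[OF d] by blast
    have R: "R \<ge> 1" by (simp add: R_def)
    \<comment> \<open>The orbit of \<open>x\<close> stays in the small ball, while its image is the
      orbit of \<open>form_map d v x\<close>, which escapes geometrically.\<close>
    have orbit: "norm ((?\<Phi> ^^ m) x) \<le> r \<and>
        2 ^ m * R < norm (form_map d v ((?\<Phi> ^^ m) x))" for m
    proof (induction m)
      case 0
      then show ?case using x big by simp
    next
      case (Suc m)
      let ?y = "form_map d v ((?\<Phi> ^^ m) x)"
      have "1 * R \<le> 2 ^ m * R" using R by (intro mult_right_mono) auto
      then have "R < norm ?y" using Suc.IH by linarith
      then have "2 * norm ?y \<le> norm (?\<Phi> ?y)" by (rule large)
      with Suc.IH comm small show ?case by (auto simp: mult.assoc)
    qed
    obtain m where m: "D * r ^ d < 2 ^ m" using real_arch_pow[of 2] by auto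
    have "norm (form_map d v ((?\<Phi> ^^ m) x)) \<le> D * norm ((?\<Phi> ^^ m) x) ^ d" by (rule D(2))
    also have "\<dots> \<le> D * r ^ d"
      using D(1) orbit[of m] by (intro mult_left_mono power_mono) auto
    also have "\<dots> < 2 ^ m * 1" using m by simp
    also have "\<dots> \<le> 2 ^ m * R" using R by (intro mult_left_mono) auto
    finally show False using orbit[of m] by simp
  qed
  with r(1) show ?thesis by blast
qed

section \<open>Finiteness through values at finitely many points\<close>

theorem theorem3p3:
  fixes \<phi> :: "'n::finite proj_space \<Rightarrow> 'n proj_space" and k d :: nat
  assumes "endomorphism_of_degree k \<phi>" and "k \<ge> 2" and "d \<ge> 1"
  shows "finite (Com \<phi> d)"
proof -
  obtain u where u: "\<And>x. form_map k u x = 0 \<Longrightarrow> x = 0"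
      "\<And>x. x \<noteq> 0 \<Longrightarrow> \<phi> (proj_point x) = proj_point (form_map k u x)"
    using assms(1) unfolding endomorphism_of_degree_iff by blast
  define D where "D = {\<alpha> :: 'n \<Rightarrow> nat. (\<Sum>j\<in>UNIV. \<alpha> j) = d}"
  define B where "B = (UNIV :: 'n set) \<times> D"
  have finD: "finite D" unfolding D_def by (rule finite_exponents)
  then have finB: "finite B" by (simp add: B_def)
  \<comment> \<open>One equation in the coefficients for each point \<open>x\<close> and component
    \<open>i\<close>: the commutation identity is imposed pointwise, so \<open>E\<close> is an
    infinite family.\<close>
  define E where "E =
    range (\<lambda>(x, i) v. form_map d v (form_map k u x) $ i - form_map k u (form_map d v x) $ i)"
  define S where "S = {v. \<forall>e\<in>E. e v = 0}"
  have S_iff: "v \<in> S \<longleftrightarrow> (\<forall>x. form_map d v (form_map k u x) = form_map k u (form_map d v x))" for v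
    unfolding S_def E_def vec_eq_iff by auto
  have value_poly: "(\<lambda>v. form_map d v x $ i) \<in> poly_fun B" for x i
    unfolding form_map_nth
    by (subst mult.commute)
      (intro poly_fun_sum poly_fun_cmult poly_fun_coord, auto simp: B_def D_def)
  have E: "E \<subseteq> poly_fun B"
  proof -
    \<comment> \<open>The outer coefficients \<open>u\<close> are fixed, so this is a polynomial in
      the values of the inner map, which are themselves polynomial in \<open>v\<close>.\<close>
    have "(\<lambda>v. form_map k u (form_map d v x) $ i) \<in> poly_fun B" for x i
      unfolding form_map_nth[of k] monomial_value_def
      by (intro poly_fun_sum poly_fun_cmult poly_fun_prod poly_fun_power value_poly)
    then show ?thesis unfolding E_def using value_poly by (auto intro!: poly_fun_diff)
  qed
  obtain r R where r: "r > 0" and R: "\<And>v x. v \<in> S \<Longrightarrow> norm x \<le> r \<Longrightarrow> norm (form_map d v x) \<le> R"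
    using commuting_form_maps_bounded[OF assms(2,3) u(1)] unfolding S_iff by metis
  have fin_values: "finite ((\<lambda>v. form_map d v x $ i) ` S)" if "norm x \<le> r" for x i
    unfolding S_def
  proof (rule bounded_poly_fun_finite_image[OF finB E value_poly])
    fix v assume "\<forall>e\<in>E. e v = 0"
    then have "v \<in> S" by (simp add: S_def)
    then show "norm (form_map d v x $ i) \<le> R"
      using R[OF _ that] Finite_Cartesian_Product.norm_nth_le order.trans by blast
  qed
  obtain T where T: "finite T" "T \<subseteq> cball 0 r" and det: "\<And>c x.
      (\<forall>x\<in>T. (\<Sum>\<alpha>\<in>D. c \<alpha> * monomial_value \<alpha> x) = 0) \<Longrightarrow> norm x \<le> r \<Longrightarrow>
        (\<Sum>\<alpha>\<in>D. c \<alpha> * monomial_value \<alpha> x) = 0"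
    using finite_determining_set[OF finD, of "cball 0 r" monomial_value] by auto
  obtain lift where lift: "\<And>\<psi>. \<psi> \<in> Com \<phi> d \<Longrightarrow> lift \<psi> \<in> S"
      "\<And>\<psi> x. \<psi> \<in> Com \<phi> d \<Longrightarrow> x \<noteq> 0 \<Longrightarrow> \<psi> (proj_point x) = proj_point (form_map d (lift \<psi>) x)"
    using commuting_lift[OF assms(2,3) u] unfolding S_iff by metis
  \<comment> \<open>The table of values of the chosen lift on \<open>T\<close>. There are finitely
    many entries with finitely many possible values each, so it remains to see that the table
    determines the map.\<close>
  define val where "val \<psi> = (\<lambda>(x, i)\<in>T \<times> UNIV. form_map d (lift \<psi>) x $ i)" for \<psi>
  have "inj_on val (Com \<phi> d)"
  proof (rule inj_onI)
    fix \<psi> \<psi>' assume \<psi>: "\<psi> \<in> Com \<phi> d" "\<psi>' \<in> Com \<phi> d" and eq: "val \<psi> = val \<psi>'"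
    have same: "form_map d (lift \<psi>) x = form_map d (lift \<psi>') x" if "norm x \<le> r" for x
    proof (subst vec_eq_iff, rule allI)
      fix i
      have diff: "form_map d (lift \<psi>) y $ i - form_map d (lift \<psi>') y $ i =
          (\<Sum>\<alpha>\<in>D. (lift \<psi> (i, \<alpha>) - lift \<psi>' (i, \<alpha>)) * monomial_value \<alpha> y)" for y
        by (simp add: D_def form_map_nth sum_subtractf left_diff_distrib)
      have "form_map d (lift \<psi>) y $ i = form_map d (lift \<psi>') y $ i" if "y \<in> T" for y
        using fun_cong[OF eq, of "(y, i)"] that by (simp add: val_def)
      then have "\<forall>y\<in>T. (\<Sum>\<alpha>\<in>D. (lift \<psi> (i, \<alpha>) - lift \<psi>' (i, \<alpha>)) * monomial_value \<alpha> y) = 0"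
        unfolding diff[symmetric] by simp
      from det[OF this that] show "form_map d (lift \<psi>) x $ i = form_map d (lift \<psi>') x $ i"
        unfolding diff[symmetric] by simp
    qed
    show "\<psi> = \<psi>'"
    proof
      fix p :: "'n proj_space"
      obtain x where x: "x \<noteq> 0" "p = proj_point x" using proj_point_exhaust by blast
      \<comment> \<open>Rescaling to norm \<open>r\<close> puts a representative of \<open>p\<close>
        into the ball, where the two lifts agree.\<close>
      define t where "t = complex_of_real (r / norm x)"
      have "t \<noteq> 0" using r x(1) by (simp add: t_def)
      then have tx: "t *s x \<noteq> 0" using x(1) by simp
      then have p: "p = proj_point (t *s x)"
        using proj_point_eq_iff[OF tx x(1)] \<open>t \<noteq> 0\<close> x(2) by auto
      have "norm (t *s x) \<le> r" unfolding norm_smult_vec t_def norm_of_real using r x(1) by simp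
      with lift(2)[OF \<psi>(1) tx] lift(2)[OF \<psi>(2) tx] show "\<psi> p = \<psi>' p"
        by (simp add: p same)
    qed
  qed
  moreover have "val ` Com \<phi> d \<subseteq> (\<Pi>\<^sub>E (x, i)\<in>T \<times> UNIV. (\<lambda>v. form_map d v x $ i) ` S)"
    using lift(1) by (auto simp: val_def split: if_splits)
  moreover have "finite (\<Pi>\<^sub>E (x, i)\<in>T \<times> UNIV. (\<lambda>v. form_map d v x $ i) ` S)"
    using T fin_values by (intro finite_PiE) auto
  ultimately show ?thesis
    using finite_subset finite_imageD by blast
qed

end
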